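(* Let $O\neq I$ be points of a Desargues affine plane, and let $B,C\in\ell^{OI}$ be two different fixed points. Then the ratio map $r_{BC}:\ell^{OI}\to\ell^{OI}$, $r_{BC}(X)=r(X,B;C)=(B-C)^{-1}\cdot(X-C)$, is a bijection of the line $\ell^{OI}$ onto itself.
   Context: An affine plane consists of a nonempty set of points and a nonempty set of lines (sets of points) such that: any two distinct points $P,Q$ lie on exactly one line $\ell^{PQ}$; for every line $\ell$ and every point $P\notin\ell$ there is exactly one line through $P$ disjoint from $\ell$; and there exist three non-collinear points. Two lines are parallel if they are equal or disjoint. A Desargues affine plane is an affine plane satisfying Desargues' axiom: if $A,B,C,A',B',C'$ are points such that $\ell^{AA'},\ell^{BB'},\ell^{CC'},\ell^{AC},\ell^{A'C'}$ are pairwise distinct lines, $\ell^{AA'},\ell^{BB'},\ell^{CC'}$ are either all parallel or all pass through one common point, $\ell^{AB}\neq\ell^{A'B'}$, $\ell^{BC}\neq\ell^{B'C'}$, $\ell^{AB}\parallel\ell^{A'B'}$ and $\ell^{BC}\parallel\ell^{B'C'}$, then $\ell^{AC}\parallel\ell^{A'C'}$. Fix distinct points $O,I$. For $A,B\in\ell^{OI}$ choose an auxiliary point $B_1\notin\ell^{OI}$. Addition: let $P_1$ be the intersection of the line through $B_1$ parallel to $\ell^{OI}$ with the line through $A$ parallel to $\ell^{OB_1}$; then $A+B$ is the intersection of $\ell^{OI}$ with the line through $P_1$ parallel to $\ell^{BB_1}$. Multiplication: let $P_1$ be the intersection of the line through $A$ parallel to $\ell^{IB_1}$ with $\ell^{OB_1}$;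 then $A\cdot B$ is the intersection of $\ell^{OI}$ with the line through $P_1$ parallel to $\ell^{BB_1}$. It is known that these operations do not depend on $B_1$ and that $(\ell^{OI},+,\cdot)$ is a skew field (division ring) with zero $O$ and identity $I$; inverses and differences are taken in this skew field. For $A,B,C\in\ell^{OI}$ with $B\neq C$, the ratio of the three points is the point $r(A,B;C)=(B-C)^{-1}\cdot(A-C)\in\ell^{OI}$. *)

theory Defs
  imports "HOL-Algebra.Ring"
begin

locale affine_plane =
  fixes Pts :: "'p set" and Lns :: "'p set set"
  assumes points_nonempty: "Pts \<noteq> {}"
    and lines_nonempty: "Lns \<noteq> {}"
    and lines_subset: "\<And>l. l \<in> Lns \<Longrightarrow> l \<subseteq> Pts"
    and unique_line:
      "\<And>P Q. \<lbrakk>P \<in> Pts; Q \<in> Pts; P \<noteq> Q\<rbrakk> \<Longrightarrow> \<exists>!l. l \<in> Lns \<and> P \<in> l \<and> Q \<in> l"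
    and unique_parallel:
      "\<And>l P. \<lbrakk>l \<in> Lns; P \<in> Pts; P \<notin> l\<rbrakk> \<Longrightarrow> \<exists>!m. m \<in> Lns \<and> P \<in> m \<and> m \<inter> l = {}"
    and non_collinear:
      "\<exists>A\<in>Pts. \<exists>B\<in>Pts. \<exists>C\<in>Pts. A \<noteq> B \<and> A \<noteq> C \<and> B \<noteq> C \<and>
         \<not> (\<exists>l\<in>Lns. A \<in> l \<and> B \<in> l \<and> C \<in> l)"
begin

definition line :: "'p \<Rightarrow> 'p \<Rightarrow> 'p set"
  where "line P Q = (THE l. l \<in> Lns \<and> P \<in> l \<and> Q \<in> l)"

definition parallel :: "'p set \<Rightarrow> 'p set \<Rightarrow> bool"  (infix "\<parallel>" 50)
  where "l \<parallel> m \<longleftrightarrow> l = m \<or> l \<inter> m = {}"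

definition parallel_through :: "'p \<Rightarrow> 'p set \<Rightarrow> 'p set"
  where "parallel_through P l = (THE m. m \<in> Lns \<and> P \<in> m \<and> m \<parallel> l)"

definition meet :: "'p set \<Rightarrow> 'p set \<Rightarrow> 'p"
  where "meet l m = (THE P. P \<in> l \<and> P \<in> m)"

text \<open>
  In the following, \<open>Z\<close> is the origin (usually written \<open>O\<close>, which is infix syntax for relation
  composition) and \<open>I\<close> the unit point of the coordinate line; \<open>B1\<close> is the auxiliary point.
\<close>

definition add_via :: "'p \<Rightarrow> 'p \<Rightarrow> 'p \<Rightarrow> 'p \<Rightarrow> 'p \<Rightarrow> 'p"
  where "add_via Z I B1 A B =
    (let P1 = meet (parallel_through B1 (line Z I)) (parallel_through A (line Z B1))
     in meet (line Z I) (parallel_through P1 (line B B1)))"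

definition mult_via :: "'p \<Rightarrow> 'p \<Rightarrow> 'p \<Rightarrow> 'p \<Rightarrow> 'p \<Rightarrow> 'p"
  where "mult_via Z I B1 A B =
    (let P1 = meet (parallel_through A (line I B1)) (line Z B1)
     in meet (line Z I) (parallel_through P1 (line B B1)))"

text \<open>
  In a Desargues affine plane neither operation depends on the auxiliary point, so an arbitrary
  choice is made.
\<close>

definition aux_point :: "'p \<Rightarrow> 'p \<Rightarrow> 'p"
  where "aux_point Z I = (SOME B1. B1 \<in> Pts \<and> B1 \<notin> line Z I)"

definition line_ring :: "'p \<Rightarrow> 'p \<Rightarrow> 'p ring"
  where "line_ring Z I =
    \<lparr>carrier = line Z I,
     mult = mult_via Z I (aux_point Z I), one = I,
     zero = Z, add = add_via Z I (aux_point Z I)\<rparr>"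

definition ratio :: "'p \<Rightarrow> 'p \<Rightarrow> 'p \<Rightarrow> 'p \<Rightarrow> 'p \<Rightarrow> 'p"
  where "ratio Z I A B C =
    inv\<^bsub>line_ring Z I\<^esub> (B \<ominus>\<^bsub>line_ring Z I\<^esub> C) \<otimes>\<^bsub>line_ring Z I\<^esub> (A \<ominus>\<^bsub>line_ring Z I\<^esub> C)"

end

text \<open>
  The point inequalities in Desargues' axiom only ensure that each line occurring in it is
  determined by two distinct points.
\<close>

locale desargues_affine_plane = affine_plane +
  assumes desargues:
    "\<And>A B C A' B' C'.
      \<lbrakk>{A, B, C, A', B', C'} \<subseteq> Pts;
       A \<noteq> A' \<and> B \<noteq> B' \<and> C \<noteq> C';
       A \<noteq> B \<and> B \<noteq> C \<and> A \<noteq> C;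
       A' \<noteq> B' \<and> B' \<noteq> C' \<and> A' \<noteq> C';
       distinct [line A A', line B B', line C C', line A C, line A' C'];
       (line A A' \<parallel> line B B' \<and> line B B' \<parallel> line C C' \<and> line A A' \<parallel> line C C') \<or>
       (\<exists>V\<in>Pts. V \<in> line A A' \<and> V \<in> line B B' \<and> V \<in> line C C');
       line A B \<noteq> line A' B'; line B C \<noteq> line B' C';
       line A B \<parallel> line A' B'; line B C \<parallel> line B' C'\<rbrakk>
      \<Longrightarrow> line A C \<parallel> line A' C'"

end

theory Submission imports Defs begin

text \<open>
  With the auxiliary point fixed, each translation \<open>X \<mapsto> X + A\<close> is a composition of two parallel
  projections, and each of the maps \<open>Y \<mapsto> A + Y\<close> and \<open>Y \<mapsto> A \<cdot> Y\<close> (with \<open>A \<noteq> 0\<close> for the product)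
  carries the pencil of lines through one point to the pencil of parallel lines through another; so
  all of them are bijections of the line in any affine plane. Desargues' axiom is only needed to
  see that right inverses are two-sided, which makes the additive and multiplicative inverses of
  the ring structure well defined. Both cases are the same hexagon theorem for three lines of a
  pencil, which is parallel for addition and concurrent for multiplication.
\<close>

lemma bij_betw_ex1:
  assumes "bij_betw f A B" "y \<in> B"
  shows "\<exists>!x. x \<in> A \<and> f x = y"
  using assms unfolding bij_betw_def inj_on_def by blast

section \<open>Incidence and parallelism in an affine plane\<close>

context affine_plane
begin

lemma line_eqI:
  assumes "l \<in> Lns" "P \<in> l" "Q \<in> l" "P \<noteq> Q"
  shows "line P Q = l"
  unfolding line_def
proof (rule the1_equality)
  show "\<exists>!l. l \<in> Lns \<and> P \<in> l \<and> Q \<in> l"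
    using assms unique_line lines_subset by blast
qed (use assms in auto)

lemma line_props:
  assumes "P \<in> Pts" "Q \<in> Pts" "P \<noteq> Q"
  shows "line P Q \<in> Lns" "P \<in> line P Q" "Q \<in> line P Q"
  using theI'[OF unique_line[OF assms]] unfolding line_def by auto

lemma line_commute: "line P Q = line Q P"
  unfolding line_def by (simp add: conj_commute)

lemma lines_meet_once:
  assumes "l \<in> Lns" "m \<in> Lns" "P \<in> l" "P \<in> m" "Q \<in> l" "Q \<in> m" "l \<noteq> m"
  shows "P = Q"
  using assms line_eqI by metis

lemma parallel_refl [simp]: "l \<parallel> l"
  by (simp add: parallel_def)

lemma parallel_sym: "l \<parallel> m \<Longrightarrow> m \<parallel> l"
  by (auto simp: parallel_def)

lemma parallel_eqI: "l \<parallel> m \<Longrightarrow> P \<in> l \<Longrightarrow> P \<in> m \<Longrightarrow> l = m"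
  by (auto simp: parallel_def)

text \<open>A common point \<open>P\<close> of distinct \<open>l\<close> and \<open>n\<close> cannot
  lie on \<open>m\<close>, so \<open>l\<close> and \<open>n\<close> would be two lines through
  \<open>P\<close> disjoint from \<open>m\<close>.\<close>

lemma parallel_trans:
  assumes "l \<in> Lns" "m \<in> Lns" "n \<in> Lns" "l \<parallel> m" "m \<parallel> n"
  shows "l \<parallel> n"
proof (rule ccontr)
  assume not_parallel: "\<not> l \<parallel> n"
  then obtain P where P: "P \<in> l" "P \<in> n" "l \<noteq> n" by (auto simp: parallel_def)
  have "P \<notin> m" using assms P not_parallel parallel_eqI by blast
  moreover have "l \<inter> m = {}" "n \<inter> m = {}"
    using assms not_parallel by (auto simp: parallel_def)
  moreover have "P \<in> Pts" using assms P lines_subset by blast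
  ultimately show False using unique_parallel[of m P] assms P by blast
qed

lemma parallel_through_unique:
  assumes "l \<in> Lns" "P \<in> Pts"
  shows "\<exists>!m. m \<in> Lns \<and> P \<in> m \<and> m \<parallel> l"
proof (cases "P \<in> l")
  case True
  then show ?thesis using assms by (intro ex1I[of _ l]) (auto simp: parallel_def)
next
  case False
  then show ?thesis using unique_parallel[OF assms] unfolding parallel_def by blast
qed

lemma parallel_through_props:
  assumes "l \<in> Lns" "P \<in> Pts"
  shows "parallel_through P l \<in> Lns" "P \<in> parallel_through P l" "parallel_through P l \<parallel> l"
  using theI'[OF parallel_through_unique[OF assms]] unfolding parallel_through_def by auto

lemma parallel_through_eqI:
  assumes "l \<in> Lns" "m \<in> Lns" "P \<in> m" "m \<parallel> l"
  shows "parallel_through P l = m"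
  using assms parallel_through_unique[of l P] parallel_through_props[of l P] lines_subset by blast

lemma meet_eqI:
  assumes "l \<in> Lns" "m \<in> Lns" "l \<noteq> m" "P \<in> l" "P \<in> m"
  shows "meet l m = P"
  unfolding meet_def using assms lines_meet_once by (intro the_equality) auto

lemma meet_props:
  assumes "l \<in> Lns" "m \<in> Lns" "\<not> l \<parallel> m"
  shows "meet l m \<in> l" "meet l m \<in> m"
  using assms meet_eqI[of l m] by (auto simp: parallel_def)

lemma meet_commute: "meet l m = meet m l"
  unfolding meet_def by (simp add: conj_commute)

lemma not_parallel_transfer:
  assumes "l \<in> Lns" "m \<in> Lns" "n \<in> Lns" "m \<parallel> l" "\<not> l \<parallel> n"
  shows "\<not> m \<parallel> n" "\<not> n \<parallel> m"
  using assms parallel_trans[of l m n] parallel_sym by auto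

section \<open>Parallel projections and maps between pencils of lines\<close>

lemma parallel_projection:
  assumes "l \<in> Lns" "m \<in> Lns" "d \<in> Lns" "\<not> d \<parallel> l" "\<not> d \<parallel> m" "X \<in> l"
  defines "Y \<equiv> meet m (parallel_through X d)"
  shows "Y \<in> m" "meet l (parallel_through Y d) = X" "Y \<in> parallel_through X d"
proof -
  have "X \<in> Pts" using assms lines_subset by blast
  note X = parallel_through_props[OF \<open>d \<in> Lns\<close> this]
  have not_par: "\<not> m \<parallel> parallel_through X d" "\<not> l \<parallel> parallel_through X d"
    using not_parallel_transfer(2)[OF assms(3) X(1) _ X(3)] assms(1,2,4,5) by auto
  then show Y: "Y \<in> m" "Y \<in> parallel_through X d"
    using meet_props[OF assms(2) X(1) not_par(1)] unfolding Y_def by auto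
  then have "parallel_through Y d = parallel_through X d"
    using parallel_through_eqI[OF assms(3) X(1) _ X(3)] by simp
  moreover have "meet l (parallel_through X d) = X"
    using X assms(1,6) not_par(2) by (intro meet_eqI) auto
  ultimately show "meet l (parallel_through Y d) = X" by simp
qed

lemma bij_betw_parallel_projection:
  assumes "l \<in> Lns" "m \<in> Lns" "d \<in> Lns" "\<not> d \<parallel> l" "\<not> d \<parallel> m"
  shows "bij_betw (\<lambda>X. meet m (parallel_through X d)) l m"
  using assms parallel_projection[of l m d] parallel_projection[of m l d]
  by (intro bij_betw_byWitness[where f' = "\<lambda>X. meet l (parallel_through X d)"]) auto

text \<open>With \<open>Q\<close> the auxiliary point and \<open>P\<close> the intermediate point of
  a left operand, \<open>W\<close> is the sum or product with right operand
  \<open>Y\<close>.\<close>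

lemma pencil_map:
  assumes l: "l \<in> Lns" and P: "P \<in> Pts" "P \<notin> l" and Q: "Q \<in> Pts" "Q \<notin> l" and Y: "Y \<in> l"
  defines "W \<equiv> meet l (parallel_through P (line Y Q))"
  shows "W \<in> l" "line P W \<parallel> line Y Q"
proof -
  have "Y \<in> Pts" "Y \<noteq> Q" using assms lines_subset by auto
  note YQ = line_props[OF this(1) Q(1) this(2)]
  note p = parallel_through_props[OF YQ(1) P(1)]
  have "\<not> line Y Q \<parallel> l" using YQ Y Q parallel_eqI by blast
  then have "\<not> l \<parallel> parallel_through P (line Y Q)"
    by (rule not_parallel_transfer(2)[OF YQ(1) p(1) l p(3)])
  then have W: "W \<in> l" "W \<in> parallel_through P (line Y Q)"
    using meet_props l p unfolding W_def by auto
  then show "W \<in> l" by simp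
  have "line P W = parallel_through P (line Y Q)"
    using W p P by (intro line_eqI) auto
  then show "line P W \<parallel> line Y Q" using p by simp
qed

text \<open>Turns an equation for a sum or product into a parallelism, the form in which Desargues'
  axiom can be applied.\<close>

lemma pencil_map_eq_iff:
  assumes "l \<in> Lns" "P \<in> Pts" "P \<notin> l" "Q \<in> Pts" "Q \<notin> l" "Y \<in> l" "W \<in> l"
  shows "meet l (parallel_through P (line Y Q)) = W \<longleftrightarrow> line P W \<parallel> line Y Q"
proof
  assume *: "line P W \<parallel> line Y Q"
  have YW: "Y \<in> Pts" "W \<in> Pts" "Y \<noteq> Q" "P \<noteq> W" using assms lines_subset by auto
  have "parallel_through P (line Y Q) = line P W"
    using * YW assms line_props by (intro parallel_through_eqI) auto
  moreover have "meet l (line P W) = W"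
    using YW assms line_props[of P W] by (intro meet_eqI) auto
  ultimately show "meet l (parallel_through P (line Y Q)) = W" by simp
qed (use pencil_map assms in blast)

text \<open>Parallelism is symmetric, so exchanging \<open>P\<close> and \<open>Q\<close> gives the
  inverse map.\<close>

lemma bij_betw_pencil_map:
  assumes "l \<in> Lns" "P \<in> Pts" "P \<notin> l" "Q \<in> Pts" "Q \<notin> l"
  shows "bij_betw (\<lambda>Y. meet l (parallel_through P (line Y Q))) l l"
proof (rule bij_betw_byWitness[where f' = "\<lambda>Y. meet l (parallel_through Q (line Y P))"])
  have inverse: "meet l (parallel_through R (line (meet l (parallel_through S (line Y R))) S)) = Y"
    if "Y \<in> l" "R \<in> Pts" "R \<notin> l" "S \<in> Pts" "S \<notin> l" for Y R S
  proof -
    note W = pencil_map[OF assms(1) that(4,5,2,3,1)]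
    have "line R Y \<parallel> line (meet l (parallel_through S (line Y R))) S"
      using W(2) parallel_sym line_commute by metis
    then show ?thesis using pencil_map_eq_iff W that assms by blast
  qed
  show "\<forall>Y\<in>l. meet l (parallel_through Q (line (meet l (parallel_through P (line Y Q))) P)) = Y"
    "\<forall>Y\<in>l. meet l (parallel_through P (line (meet l (parallel_through Q (line Y P))) Q)) = Y"
    using inverse assms by auto
qed (use assms pencil_map in auto)

text \<open>The common intersection is empty (parallel lines) or a single point (concurrent lines).\<close>

definition pencil :: "'p set \<Rightarrow> 'p set \<Rightarrow> 'p set \<Rightarrow> bool"
  where "pencil l m k \<longleftrightarrow>
    {l, m, k} \<subseteq> Lns \<and> distinct [l, m, k] \<and> l \<inter> m = m \<inter> k \<and> l \<inter> k = m \<inter> k"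

lemma pencil_permute:
  assumes "pencil l m k"
  shows "pencil m l k" "pencil l k m"
proof -
  have L: "{l, m, k} \<subseteq> Lns" "distinct [l, m, k]" and int: "l \<inter> m = m \<inter> k" "l \<inter> k = m \<inter> k"
    using assms unfolding pencil_def by blast+
  have "m \<inter> l = l \<inter> k" "m \<inter> k = l \<inter> k" "l \<inter> k = k \<inter> m" "l \<inter> m = k \<inter> m"
    using int by blast+
  then show "pencil m l k" "pencil l k m"
    using L unfolding pencil_def by auto
qed

text \<open>Parallel lines through \<open>A\<close> coincide, and a line through a point off
  \<open>m\<close> meets \<open>m\<close> at most once.\<close>

lemma parallel_joins_unique:
  assumes "m \<in> Lns" "A \<in> Pts" "A \<notin> m" "B \<in> m" "B' \<in> m" "line A B \<parallel> line A B'"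
  shows "B = B'"
proof -
  have "B \<in> Pts" "B' \<in> Pts" "A \<noteq> B" "A \<noteq> B'" using assms lines_subset by auto
  note B = line_props[OF assms(2) this(1,3)] and B' = line_props[OF assms(2) this(2,4)]
  have "line A B = line A B'" using B B' assms parallel_eqI by blast
  then show ?thesis using lines_meet_once[of m "line A B" B B'] B B' assms by auto
qed

end

section \<open>Desargues' axiom for pencils and the hexagon theorem\<close>

context desargues_affine_plane
begin

text \<open>Replaces the distinctness conditions of the axiom by incidence conditions: two triangles
  that share a vertex are equal, and if \<open>line A C = line A' C'\<close> the claim is
  trivial.\<close>

lemma desargues_pencil:
  assumes pencil: "pencil l m k"
    and on: "A \<in> l" "A' \<in> l" "B \<in> m" "B' \<in> m" "C \<in> k" "C' \<in> k"
    and off: "A \<notin> m" "A' \<notin> m" "B \<notin> l" "B' \<notin> l" "C \<notin> l" "C' \<notin> l"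
    and AB: "line A B \<parallel> line A' B'" and BC: "line B C \<parallel> line B' C'"
  shows "line A C \<parallel> line A' C'"
proof -
  have L: "l \<in> Lns" "m \<in> Lns" "k \<in> Lns" "l \<noteq> m" "m \<noteq> k" "l \<noteq> k"
    and int: "l \<inter> m = m \<inter> k" "l \<inter> k = m \<inter> k"
    using pencil by (auto simp: pencil_def)
  have off': "A \<notin> k" "A' \<notin> k" "B \<notin> k" "B' \<notin> k" "C \<notin> m" "C' \<notin> m"
    using on off int by blast+
  have pts: "A \<in> Pts" "A' \<in> Pts" "B \<in> Pts" "B' \<in> Pts" "C \<in> Pts" "C' \<in> Pts"
    using L on lines_subset by blast+
  have ne: "A \<noteq> B" "B \<noteq> C" "A \<noteq> C" "A' \<noteq> B'" "B' \<noteq> C'" "A' \<noteq> C'"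
    using on off off' by auto
  have AB_iff: "A = A' \<longleftrightarrow> B = B'"
    using AB parallel_joins_unique[of m A B B'] parallel_joins_unique[of l B A A']
      L on off pts line_commute by metis
  have BC_iff: "B = B' \<longleftrightarrow> C = C'"
    using BC parallel_joins_unique[of k B C C'] parallel_joins_unique[of m C B B']
      L on off' pts line_commute by metis
  show ?thesis
  proof (cases "A = A' \<or> line A C = line A' C'")
    case True
    then show ?thesis using AB_iff BC_iff by auto
  next
    case False
    then have ne': "A \<noteq> A'" "B \<noteq> B'" "C \<noteq> C'" and AC_ne: "line A C \<noteq> line A' C'"
      using AB_iff BC_iff by auto
    have lines: "line A A' = l" "line B B' = m" "line C C' = k"
      using L on ne' line_eqI by auto
    note AC = line_props[OF pts(1) pts(5) ne(3)] line_props[OF pts(2) pts(6) ne(6)]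
    note ABl = line_props[OF pts(1) pts(3) ne(1)] line_props[OF pts(2) pts(4) ne(4)]
    note BCl = line_props[OF pts(3) pts(5) ne(2)] line_props[OF pts(4) pts(6) ne(5)]
    have "distinct [line A A', line B B', line C C', line A C, line A' C']"
      using L AC_ne AC off off' unfolding lines by auto
    \<comment> \<open>The three lines have the same pairwise intersection: if it is empty they are
      parallel, otherwise any of its points serves as \<open>V\<close>.\<close>
    moreover have "line A A' \<parallel> line B B' \<and> line B B' \<parallel> line C C' \<and> line A A' \<parallel> line C C' \<or>
        (\<exists>V\<in>Pts. V \<in> line A A' \<and> V \<in> line B B' \<and> V \<in> line C C')"
      unfolding lines parallel_def using int L lines_subset by blast
    \<comment> \<open>Otherwise this line would contain \<open>A\<close> and \<open>A'\<close>,
      hence equal \<open>l\<close>, although \<open>B\<close> is off \<open>l\<close>.\<close>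
    moreover have "line A B \<noteq> line A' B'"
      using lines_meet_once[of l "line A B" A A'] ABl L on off ne' by auto
    moreover have "line B C \<noteq> line B' C'"
      using lines_meet_once[of m "line B C" B B'] BCl L on off' ne' by auto
    ultimately show ?thesis
      using desargues[of A B C A' B' C'] pts ne ne' AB BC by blast
  qed
qed

text \<open>
  The map taking \<open>A, P, E, F\<close> to \<open>E, F, B, R\<close> acts like a translation or homothety.
  It is extended to a point \<open>Q\<close> off \<open>l\<close> and \<open>m\<close>; four applications of Desargues' axiom then
  transport parallelism around the hexagon.
\<close>

lemma desargues_hexagon:
  assumes pencil: "pencil l m k" and Q: "Q \<in> k" "Q \<notin> l"
    and on: "A \<in> l" "E \<in> l" "B \<in> l" "P \<in> m" "F \<in> m" "R \<in> m"
    and off: "A \<notin> m" "E \<notin> m" "B \<notin> m" "P \<notin> l" "F \<notin> l" "R \<notin> l"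
    and par: "line A P \<parallel> line E F" "line E P \<parallel> line B F" "line E F \<parallel> line B R"
  shows "line A F \<parallel> line E R"
proof -
  have L: "l \<in> Lns" "m \<in> Lns" "k \<in> Lns" "l \<noteq> m" "m \<noteq> k" "l \<noteq> k"
    and int: "l \<inter> m = m \<inter> k" "l \<inter> k = m \<inter> k"
    using pencil by (auto simp: pencil_def)
  have pts: "A \<in> Pts" "E \<in> Pts" "Q \<in> Pts" using L on Q lines_subset by blast+
  have "A \<noteq> Q" using on Q by auto
  note AQ = line_props[OF pts(1,3) this]
  note p = parallel_through_props[OF AQ(1) pts(2)]
  have AE: "A \<notin> k" "E \<notin> k" using on off int by blast+
  then have "\<not> line A Q \<parallel> k" using AQ Q parallel_eqI by blast
  then have "\<not> k \<parallel> parallel_through E (line A Q)"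
    by (rule not_parallel_transfer(2)[OF AQ(1) p(1) L(3) p(3)])
  \<comment> \<open>\<open>Q'\<close> is the image of \<open>Q\<close> under the extended map: it
    lies on \<open>k\<close>, and \<open>E Q'\<close> has the direction of
    \<open>A Q\<close>.\<close>
  then obtain Q' where Q': "Q' \<in> k" "Q' \<in> parallel_through E (line A Q)"
    by (auto simp: parallel_def)
  have "Q' \<noteq> E" using Q' \<open>E \<notin> k\<close> by auto
  then have EQ': "line E Q' = parallel_through E (line A Q)" using Q' p by (intro line_eqI) auto
  then have 0: "line A Q \<parallel> line E Q'" using p parallel_sym by simp
  have Q'_off: "Q' \<notin> l"
  proof
    assume "Q' \<in> l"
    then have "l \<parallel> line A Q" using line_eqI[of l E Q'] L on \<open>Q' \<noteq> E\<close> EQ' p by auto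
    then show False using parallel_eqI[of l _ A] AQ on Q by blast
  qed
  have off': "Q \<notin> m" "Q' \<notin> m" using Q Q' Q'_off int by blast+
  have pencils: "pencil m l k" "pencil l k m"
    using pencil_permute[OF pencil] by simp_all
  \<comment> \<open>The triangles are, in turn, \<open>P A Q\<close> and \<open>F E Q'\<close>,
    \<open>E P Q\<close> and \<open>B F Q'\<close>, \<open>F E Q\<close> and \<open>R B Q'\<close>,
    \<open>A Q F\<close> and \<open>E Q' R\<close>; each uses one parallelism obtained
    earlier.\<close>
  have 1: "line P Q \<parallel> line F Q'"
    using desargues_pencil[OF pencils(1), of P F A E Q Q'] on off Q Q' Q'_off off' par 0
    by (simp add: line_commute)
  have 2: "line E Q \<parallel> line B Q'"
    using desargues_pencil[OF pencil, of E B P F Q Q'] on off Q Q' Q'_off off' par 1 by simp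
  have 3: "line F Q \<parallel> line R Q'"
    using desargues_pencil[OF pencils(1), of F R E B Q Q'] on off Q Q' Q'_off off' par 2
    by (simp add: line_commute)
  show ?thesis
    using desargues_pencil[OF pencils(2), of A E Q Q' F R] on off Q Q' Q'_off off' AE 0 3
    by (simp add: line_commute)
qed

end

section \<open>The coordinate line with an arbitrary auxiliary point \<open>U\<close>\<close>

locale coordinate_line = desargues_affine_plane Pts Lns for Pts :: "'p set" and Lns +
  fixes Z I U :: 'p
  assumes Z: "Z \<in> Pts" and I: "I \<in> Pts" and ZI: "Z \<noteq> I"
    and U: "U \<in> Pts" "U \<notin> line Z I"
begin

abbreviation "l \<equiv> line Z I"
abbreviation "m \<equiv> parallel_through U l"
abbreviation "n \<equiv> line Z U"
abbreviation "d \<equiv> line I U"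

lemma l: "l \<in> Lns" "Z \<in> l" "I \<in> l"
  using line_props[OF Z I ZI] by auto

lemma l_Pts: "X \<in> l \<Longrightarrow> X \<in> Pts"
  using l lines_subset by blast

lemma join_U:
  assumes "X \<in> l"
  shows "line X U \<in> Lns" "X \<in> line X U" "U \<in> line X U" "\<not> line X U \<parallel> l" "line X U \<inter> l = {X}"
proof -
  have "X \<noteq> U" using U assms by auto
  note X = line_props[OF l_Pts[OF assms] U(1) this]
  then show "line X U \<in> Lns" "X \<in> line X U" "U \<in> line X U" by auto
  show "\<not> line X U \<parallel> l" using X U assms parallel_eqI by blast
  show "line X U \<inter> l = {X}" using lines_meet_once[of "line X U" l] l X U assms by auto
qed

lemmas n = join_U[OF l(2)] and d = join_U[OF l(3)]

lemma m: "m \<in> Lns" "U \<in> m" "m \<inter> l = {}"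
  using parallel_through_props[OF l(1) U(1)] U by (auto simp: parallel_def)

lemma join_U_not_parallel_m:
  assumes "X \<in> l"
  shows "\<not> line X U \<parallel> m"
  using join_U[OF assms] m assms parallel_eqI by blast

lemma d_n: "\<not> d \<parallel> n"
  using d n l ZI parallel_eqI[of d n U] by auto

text \<open>These are the points \<open>P1\<close> of the two constructions. They depend on the left
  operand only, so fixing it leaves a pencil map in the right operand.\<close>

definition add_pt where "add_pt A = meet m (parallel_through A n)"
definition mult_pt where "mult_pt A = meet n (parallel_through A d)"

lemma add_via_eq: "add_via Z I U A B = meet l (parallel_through (add_pt A) (line B U))"
  by (simp add: add_via_def add_pt_def Let_def)

lemma mult_via_eq: "mult_via Z I U A B = meet l (parallel_through (mult_pt A) (line B U))"
  by (simp add: mult_via_def mult_pt_def Let_def meet_commute)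

lemma add_pt:
  assumes "A \<in> l"
  shows "add_pt A \<in> m" "add_pt A \<notin> l" "add_pt A \<in> Pts" "line A (add_pt A) \<parallel> n"
proof -
  have nm: "\<not> n \<parallel> m" by (rule join_U_not_parallel_m[OF l(2)])
  note * = parallel_projection[OF l(1) m(1) n(1) n(4) nm assms, folded add_pt_def]
  note p = parallel_through_props[OF n(1) l_Pts[OF assms]]
  show "add_pt A \<in> m" by fact
  then show "add_pt A \<notin> l" "add_pt A \<in> Pts" using m lines_subset by blast+
  then have "line A (add_pt A) = parallel_through A n"
    using * p assms by (intro line_eqI) auto
  then show "line A (add_pt A) \<parallel> n" using p by simp
qed

lemma mult_pt:
  assumes "A \<in> l" "A \<noteq> Z"
  shows "mult_pt A \<in> n" "mult_pt A \<notin> l" "mult_pt A \<in> Pts" "line A (mult_pt A) \<parallel> d"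
proof -
  note * = parallel_projection[OF l(1) n(1) d(1) d(4) d_n assms(1), folded mult_pt_def]
  note p = parallel_through_props[OF d(1) l_Pts[OF assms(1)]]
  have np: "\<not> parallel_through A d \<parallel> l"
    by (rule not_parallel_transfer(1)[OF d(1) p(1) l(1) p(3) d(4)])
  show "mult_pt A \<in> n" by fact
  then show "mult_pt A \<in> Pts" using n lines_subset by blast
  have "A \<notin> n" using n(5) assms by blast
  then have "mult_pt A \<noteq> A" "parallel_through A d \<noteq> l"
    using np \<open>mult_pt A \<in> n\<close> by (metis, metis parallel_refl)
  then show notin: "mult_pt A \<notin> l"
    using lines_meet_once[OF p(1) l(1) p(2) assms(1) *(3)] by auto
  then have "line A (mult_pt A) = parallel_through A d"
    using * p assms by (intro line_eqI) auto
  then show "line A (mult_pt A) \<parallel> d" using p by simp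
qed

lemma mult_pt_Z: "mult_pt Z = Z"
proof -
  note p = parallel_through_props[OF d(1) Z]
  have "parallel_through Z d \<noteq> n" using p d_n parallel_sym by metis
  then show ?thesis unfolding mult_pt_def using n p by (intro meet_eqI) auto
qed

text \<open>Project \<open>l\<close> to \<open>m\<close> along \<open>n\<close>, then back along
  \<open>line D U\<close>; both directions are transversal to \<open>l\<close> and
  \<open>m\<close>.\<close>

lemma bij_add_right:
  assumes "D \<in> l"
  shows "bij_betw (\<lambda>X. add_via Z I U X D) l l"
  unfolding add_via_eq add_pt_def
  using bij_betw_trans[OF bij_betw_parallel_projection[of l m n]
      bij_betw_parallel_projection[of m l "line D U"]]
    l m n join_U[OF assms] join_U_not_parallel_m[OF assms] join_U_not_parallel_m[OF l(2)]
  by (simp add: comp_def)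

lemma bij_add_left:
  assumes "A \<in> l"
  shows "bij_betw (add_via Z I U A) l l"
  using bij_betw_pencil_map[OF l(1) _ _ U, of "add_pt A"] add_pt[OF assms]
  by (simp add: add_via_eq[abs_def])

lemma bij_mult_left:
  assumes "A \<in> l" "A \<noteq> Z"
  shows "bij_betw (mult_via Z I U A) l l"
  using bij_betw_pencil_map[OF l(1) _ _ U, of "mult_pt A"] mult_pt[OF assms]
  by (simp add: mult_via_eq[abs_def])

text \<open>For left operand \<open>Z\<close> the intermediate point is \<open>Z\<close> itself, so
  every parallel drawn through it meets \<open>l\<close> there. This later shows that an inverse is
  nonzero.\<close>

lemma mult_Z_left: "B \<in> l \<Longrightarrow> mult_via Z I U Z B = Z"
  unfolding mult_via_eq mult_pt_Z
  using join_U[of B] l parallel_through_props[of "line B U" Z] Z parallel_sym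
  by (intro meet_eqI) auto

section \<open>Sums and products as parallelisms; two-sided inverses\<close>

lemma add_eq_iff:
  assumes "A \<in> l" "B \<in> l" "W \<in> l"
  shows "add_via Z I U A B = W \<longleftrightarrow> line W (add_pt A) \<parallel> line B U"
  using pencil_map_eq_iff[OF l(1) _ _ U, of "add_pt A" B W] add_pt[OF assms(1)] assms
  by (simp add: add_via_eq line_commute)

lemma mult_eq_iff:
  assumes "A \<in> l" "A \<noteq> Z" "B \<in> l" "W \<in> l"
  shows "mult_via Z I U A B = W \<longleftrightarrow> line W (mult_pt A) \<parallel> line B U"
  using pencil_map_eq_iff[OF l(1) _ _ U, of "mult_pt A" B W] mult_pt[OF assms(1,2)] assms
  by (simp add: mult_via_eq line_commute)

text \<open>Take the hexagon with \<open>A, Z, B\<close> on \<open>l\<close> and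
  \<open>add_pt A, U, add_pt B\<close> on \<open>m\<close>. Two of its parallelisms come from the
  construction of the intermediate points, the third is \<open>A + B = Z\<close>, and the conclusion
  is \<open>B + A = Z\<close>.\<close>

lemma add_inverse_commute:
  assumes A: "A \<in> l" and B: "B \<in> l" and AB: "add_via Z I U A B = Z"
  shows "add_via Z I U B A = Z"
proof (cases "A = B")
  case False
  note a = add_pt[OF A] and b = add_pt[OF B]
  have par: "line Z (add_pt A) \<parallel> line B U" using add_eq_iff[OF A B l(2)] AB by simp
  have "Z \<notin> m" using l(2) m(3) by blast
  \<comment> \<open>If one of \<open>A\<close>, \<open>B\<close> were \<open>Z\<close>, the relevant
    intermediate point would be \<open>U\<close>, forcing \<open>A U\<close> and \<open>B U\<close>
    to be parallel and hence \<open>A = B\<close>.\<close>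
  have "B \<noteq> Z"
  proof
    assume BZ: "B = Z"
    have "U = add_pt A"
      using parallel_joins_unique[OF m(1) Z, of U "add_pt A"] \<open>Z \<notin> m\<close> m a par BZ parallel_sym by auto
    then have "line A U \<parallel> line B U" using a BZ by simp
    then show False
      using parallel_joins_unique[OF l(1) U A B] False by (simp add: line_commute)
  qed
  have "A \<noteq> Z"
  proof
    assume AZ: "A = Z"
    have "U = add_pt A"
      using parallel_joins_unique[OF m(1) Z, of "add_pt A" U] \<open>Z \<notin> m\<close> m a AZ by auto
    then show False
      using parallel_joins_unique[OF l(1) U A B] False par AZ by (simp add: line_commute)
  qed
  text \<open>A third line parallel to \<open>l\<close> exists because \<open>A\<close>, \<open>B\<close>, \<open>Z\<close> are three points of \<open>l\<close>.\<close>
  define Q where "Q = meet n (parallel_through A (line B U))"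
  have nB: "\<not> line B U \<parallel> n"
    using join_U[OF B] n \<open>B \<noteq> Z\<close> parallel_eqI[of "line B U" n U] by auto
  note Q = parallel_projection[OF l(1) n(1) join_U(1)[OF B] join_U(4)[OF B] nB A, folded Q_def]
  note pA = parallel_through_props[OF join_U(1)[OF B] l_Pts[OF A]]
  have QPts: "Q \<in> Pts" using Q n lines_subset by blast
  \<comment> \<open>\<open>Q\<close> avoids \<open>l\<close> because \<open>A\<close> differs from
    \<open>Z\<close>, and avoids \<open>m\<close> because \<open>A\<close> differs from
    \<open>B\<close>.\<close>
  have "Q \<notin> l"
  proof
    assume "Q \<in> l"
    then have "Q = Z" using Q n by auto
    then have "parallel_through A (line B U) = l"
      using lines_meet_once[of l "parallel_through A (line B U)" Q A] Q pA l A \<open>A \<noteq> Z\<close> by auto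
    then show False using pA join_U(4)[OF B] parallel_sym by auto
  qed
  have "Q \<notin> m"
  proof
    assume "Q \<in> m"
    then have "Q = U"
      using lines_meet_once[of n m Q U] Q n m l by blast
    then have "parallel_through A (line B U) = line B U"
      using Q pA join_U[OF B] parallel_eqI by blast
    then show False using pA A join_U(5)[OF B] False by auto
  qed
  define k where "k = parallel_through Q l"
  have k: "k \<in> Lns" "Q \<in> k" "k \<parallel> l"
    using parallel_through_props[OF l(1) QPts] by (auto simp: k_def)
  have "m \<parallel> l" using m by (auto simp: parallel_def)
  then have "k \<parallel> m" using k l m parallel_trans parallel_sym by blast
  have "pencil l m k"
    unfolding pencil_def using l m k \<open>k \<parallel> m\<close> \<open>Q \<notin> m\<close> \<open>Q \<notin> l\<close> n
    by (auto simp: parallel_def)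
  moreover have "line Z U \<parallel> line B (add_pt B)" using b parallel_sym by simp
  ultimately have "line A U \<parallel> line Z (add_pt B)"
    using desargues_hexagon[of l m k Q A Z B "add_pt A" U "add_pt B"]
      k \<open>Q \<notin> l\<close> A B l m a b U par by blast
  then show ?thesis using add_eq_iff[OF B A l(2)] parallel_sym by blast
qed (use assms in simp)

text \<open>The same hexagon argument with \<open>I\<close> in place of \<open>Z\<close> and the
  line \<open>n\<close> in place of \<open>m\<close>; now \<open>l\<close> and \<open>n\<close> meet
  at \<open>Z\<close>.\<close>

lemma mult_inverse_commute:
  assumes A: "A \<in> l" "A \<noteq> Z" and B: "B \<in> l" and AB: "mult_via Z I U A B = I"
  shows "B \<noteq> Z" "mult_via Z I U B A = I"
proof -
  note a = mult_pt[OF A]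
  have par: "line I (mult_pt A) \<parallel> line B U" using mult_eq_iff[OF A B l(3)] AB by simp
  have "I \<notin> n" using n(5) l(3) ZI by (metis IntI singletonD)
  \<comment> \<open>For \<open>B = Z\<close> the line from \<open>I\<close> to
    \<open>mult_pt A\<close> would be parallel to \<open>n\<close> and share
    \<open>mult_pt A\<close> with it, putting \<open>I\<close> on \<open>n\<close>.\<close>
  show BZ: "B \<noteq> Z"
  proof
    assume "B = Z"
    have "I \<noteq> mult_pt A" using a l by auto
    note Ia = line_props[OF I a(3) this]
    have "line I (mult_pt A) = n" using parallel_eqI[OF par] Ia a \<open>B = Z\<close> by blast
    then show False using Ia \<open>I \<notin> n\<close> by auto
  qed
  note b = mult_pt[OF B BZ]
  text \<open>The third line through \<open>Z\<close> is the diagonal of the parallelogram with sides \<open>ZI\<close> and \<open>ZU\<close>.\<close>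
  note pI = parallel_through_props[OF n(1) I]
  have "\<not> m \<parallel> parallel_through I n"
    by (rule not_parallel_transfer(2)[OF n(1) pI(1) m(1) pI(3) join_U_not_parallel_m[OF l(2)]])
  then obtain Q where Q: "Q \<in> m" "Q \<in> parallel_through I n" by (auto simp: parallel_def)
  have "Q \<notin> l" "Q \<in> Pts" using Q m lines_subset by blast+
  have "Q \<notin> n" using Q pI \<open>I \<notin> n\<close> parallel_eqI by blast
  have "Z \<noteq> Q" using l \<open>Q \<notin> l\<close> by auto
  note k = line_props[OF Z \<open>Q \<in> Pts\<close> this]
  have ln: "l \<inter> n = {Z}" using n by auto
  have "l \<inter> line Z Q = {Z}"
    using lines_meet_once[of l "line Z Q"] l k \<open>Q \<notin> l\<close> by blast
  moreover have "n \<inter> line Z Q = {Z}"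
    using lines_meet_once[of n "line Z Q"] n k \<open>Q \<notin> n\<close> by blast
  moreover have "distinct [l, n, line Z Q]"
    using l(3) k(3) \<open>I \<notin> n\<close> \<open>Q \<notin> l\<close> \<open>Q \<notin> n\<close> by auto
  ultimately have "pencil l n (line Z Q)"
    using l(1) n(1) k(1) ln unfolding pencil_def by simp
  moreover have "A \<notin> n" "B \<notin> n" using ln A B BZ by auto
  moreover have "line I U \<parallel> line B (mult_pt B)" using b parallel_sym by simp
  ultimately have "line A U \<parallel> line I (mult_pt B)"
    using desargues_hexagon[of l n "line Z Q" Q A I B "mult_pt A" U "mult_pt B"]
      k \<open>Q \<notin> l\<close> \<open>I \<notin> n\<close> A B l n a b U par by blast
  then show "mult_via Z I U B A = I" using mult_eq_iff[OF B BZ A(1) l(3)] parallel_sym by blast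
qed

text \<open>The two-sided condition is the definite description to which \<open>a_inv\<close>
  unfolds; its uniqueness identifies the negative without the ring axioms.\<close>

lemma add_inverse:
  assumes "C \<in> l"
  shows "\<exists>!D. D \<in> l \<and> add_via Z I U C D = Z \<and> add_via Z I U D C = Z"
proof -
  have "\<exists>!D. D \<in> l \<and> add_via Z I U C D = Z"
    by (rule bij_betw_ex1[OF bij_add_left[OF assms] l(2)])
  then show ?thesis using add_inverse_commute[OF assms] by metis
qed

lemma mult_inverse:
  assumes "C \<in> l" "C \<noteq> Z"
  shows "\<exists>!D. D \<in> l \<and> mult_via Z I U C D = I \<and> mult_via Z I U D C = I"
proof -
  have "\<exists>!D. D \<in> l \<and> mult_via Z I U C D = I"
    by (rule bij_betw_ex1[OF bij_mult_left[OF assms] l(3)])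
  then show ?thesis using mult_inverse_commute(2)[OF assms] by metis
qed

end

section \<open>The ratio map\<close>

lemma (in affine_plane) exists_off_line:
  assumes "l \<in> Lns"
  shows "\<exists>U. U \<in> Pts \<and> U \<notin> l"
  using non_collinear assms by blast

theorem theorem15:
  fixes Pts :: "'p set" and Lns :: "'p set set" and Z I B C :: 'p
  assumes "desargues_affine_plane Pts Lns"
    and "Z \<in> Pts" and "I \<in> Pts" and "Z \<noteq> I"
    and "B \<in> affine_plane.line Lns Z I" and "C \<in> affine_plane.line Lns Z I" and "B \<noteq> C"
  shows "bij_betw (\<lambda>X. affine_plane.ratio Pts Lns Z I X B C)
           (affine_plane.line Lns Z I) (affine_plane.line Lns Z I)"
proof -
  interpret desargues_affine_plane Pts Lns by fact
  define U where "U = aux_point Z I"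
  have U: "U \<in> Pts \<and> U \<notin> line Z I"
    using someI_ex[OF exists_off_line[OF line_props(1)[OF assms(2-4)]]]
    by (simp add: U_def aux_point_def)
  interpret coordinate_line Pts Lns Z I U
    using U assms by unfold_locales auto
  let ?R = "line_ring Z I"
  define D where "D = \<ominus>\<^bsub>?R\<^esub> C"
  have "D \<in> l \<and> add_via Z I U C D = Z \<and> add_via Z I U D C = Z"
    using theI'[OF add_inverse[OF assms(6)]]
    by (simp add: D_def a_inv_def m_inv_def line_ring_def U_def)
  then have D: "D \<in> l" "add_via Z I U C D = Z" by auto
  have minus: "X \<ominus>\<^bsub>?R\<^esub> C = add_via Z I U X D" for X
    by (simp add: a_minus_def D_def[symmetric]) (simp add: line_ring_def U_def)
  define S where "S = add_via Z I U B D"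
  note bij = bij_add_right[OF D(1)]
  have "S \<in> l" using bij assms(5) unfolding S_def by (auto dest: bij_betwE)
  \<comment> \<open>Since \<open>C + D = Z\<close>, a vanishing \<open>B + D\<close> would
    contradict injectivity of the translation by \<open>D\<close>, as \<open>B\<close> differs from
    \<open>C\<close>.\<close>
  moreover have "S \<noteq> Z"
    using inj_onD[OF bij_betw_imp_inj_on[OF bij], of B C] assms(5-7) D(2) unfolding S_def by auto
  ultimately have S: "\<exists>!T. T \<in> l \<and> mult_via Z I U S T = I \<and> mult_via Z I U T S = I"
    by (rule mult_inverse)
  define T where "T = inv\<^bsub>?R\<^esub> S"
  have T: "T \<in> l" "mult_via Z I U T S = I"
    using theI'[OF S] by (simp_all add: T_def m_inv_def line_ring_def U_def)
  then have "T \<noteq> Z" using mult_Z_left[OF \<open>S \<in> l\<close>] ZI by auto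
  \<comment> \<open>The ratio map is the translation by \<open>D\<close> followed by left
    multiplication by the nonzero \<open>T\<close>.\<close>
  have "ratio Z I X B C = mult_via Z I U T (add_via Z I U X D)" for X
    unfolding ratio_def minus S_def[symmetric] T_def[symmetric]
    by (simp add: line_ring_def U_def)
  then show ?thesis
    using bij_betw_trans[OF bij bij_mult_left[OF T(1) \<open>T \<noteq> Z\<close>]] by (simp add: comp_def)
qed

end
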